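(* For every integer $K\ge 3$ there exists a constant $C_K>0$ such that for every positive integer $m$, $$P^{\text{flexible-consensus}}(m,K)\ge C_K,$$ where $P^{\text{flexible-consensus}}(m,K)$ is the probability that the random profile with parameters $m,K$ (in which the frequencies of the $K!$ preferences are i.i.d. binomial random variables with $m$ trials and success probability $1/K!$) exhibits Flexible Consensus around some preference.
   Context: Let $A$ be a set of $K$ alternatives and let $\mathcal{P}$ be the set of all $K!$ strict total orders on $A$, called preferences. A profile $\pi$ is a finite list of preferences (possibly with duplicates); the frequency $\mu_\pi(\succ)$ of $\succ\in\mathcal{P}$ is the number of occurrences of $\succ$ in the list. The inversion distance $d(\succ,\succ')$ is the number of two-element subsets $\{a,b\}\subseteq A$ that are ranked differently by $\succ$ and $\succ'$. $\pi$ exhibits Flexible Consensus around $\succ_0\in\mathcal{P}$ if for all $\succ',\succ\in\mathcal{P}$: $\mu_\pi(\succ')>\mu_\pi(\succ)$ implies $d(\succ',\succ_0)\le d(\succ,\succ_0)$. Random profile with parameters $m,K$ ($m$ a positive integer): enumerate $\mathcal{P}$ as $(\succ_i)_{i=1}^{K!}$; draw independent random variables $B_1,\dots,B_{K!}$, each binomial with $m$ trials and success probability $1/K!$; the profile contains exactly $B_i$ voters whose preference is $\succ_i$, for every $i$ (so the number of voters $n=\sum_i B_i$ is random). *)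

theory Defs
  imports "HOL-Probability.Probability"
begin

text \<open>A pair \<open>(a, b)\<close> in a preference means that \<open>a\<close> is ranked strictly above \<open>b\<close>.\<close>

definition preferences :: "'a set \<Rightarrow> 'a rel set" where
  "preferences A = {r. r \<subseteq> A \<times> A \<and> strict_linear_order_on A r}"

definition inversion_dist :: "'a set \<Rightarrow> 'a rel \<Rightarrow> 'a rel \<Rightarrow> nat" where
  "inversion_dist A r s =
     card {{a, b} | a b. a \<in> A \<and> b \<in> A \<and> a \<noteq> b \<and> ((a, b) \<in> r) \<noteq> ((a, b) \<in> s)}"

definition flexible_consensus :: "'a set \<Rightarrow> 'a rel list \<Rightarrow> 'a rel \<Rightarrow> bool" where
  "flexible_consensus A \<pi> r0 \<longleftrightarrow> r0 \<in> preferences A \<and>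
     (\<forall>r' \<in> preferences A. \<forall>r \<in> preferences A.
        count_list \<pi> r' > count_list \<pi> r \<longrightarrow> inversion_dist A r' r0 \<le> inversion_dist A r r0)"

text \<open>The voters are listed in blocks following the enumeration \<open>e 1, \<dots>, e (fact K)\<close> of the
  preferences; flexible consensus does not depend on the order of the list.\<close>

definition profile_of_freqs :: "nat \<Rightarrow> (nat \<Rightarrow> 'a rel) \<Rightarrow> (nat \<Rightarrow> nat) \<Rightarrow> 'a rel list" where
  "profile_of_freqs K e B = concat (map (\<lambda>i. replicate (B i) (e i)) [1..<Suc (fact K)])"

definition random_profile :: "nat \<Rightarrow> nat \<Rightarrow> (nat \<Rightarrow> 'a rel) \<Rightarrow> 'a rel list pmf" where
  "random_profile m K e =
     map_pmf (profile_of_freqs K e)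
       (Pi_pmf {1..fact K} 0 (\<lambda>_. binomial_pmf m (1 / fact K)))"

definition prob_flexible_consensus :: "nat \<Rightarrow> nat \<Rightarrow> 'a set \<Rightarrow> (nat \<Rightarrow> 'a rel) \<Rightarrow> real" where
  "prob_flexible_consensus m K A e =
     measure_pmf.prob (random_profile m K e) {\<pi>. \<exists>r0. flexible_consensus A \<pi> r0}"

lemma preferences_iff:
  "r \<in> preferences A \<longleftrightarrow> r \<subseteq> A \<times> A \<and>
     (\<forall>a b c. (a, b) \<in> r \<longrightarrow> (b, c) \<in> r \<longrightarrow> (a, c) \<in> r) \<and> (\<forall>a. (a, a) \<notin> r) \<and>
     (\<forall>a\<in>A. \<forall>b\<in>A. a \<noteq> b \<longrightarrow> (a, b) \<in> r \<or> (b, a) \<in> r)"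
  by (auto simp: preferences_def strict_linear_order_on_def trans_def irrefl_def total_on_def)

lemma preferences_max:
  assumes "finite A" "A \<noteq> {}" "r \<in> preferences A"
  shows "\<exists>x\<in>A. \<forall>y\<in>A - {x}. (x, y) \<in> r"
proof -
  have tr: "trans r" and ir: "irrefl r" and to: "total_on A r" and sub: "r \<subseteq> A \<times> A"
    using assms(3) by (auto simp: preferences_def strict_linear_order_on_def)
  have "finite r" using sub assms(1) by (meson finite_SigmaI finite_subset)
  moreover have "acyclic r" using tr ir by (simp add: acyclic_irrefl)
  ultimately have "wf r" by (rule finite_acyclic_wf)
  then obtain x where x: "x \<in> A" "\<And>y. (y, x) \<in> r \<Longrightarrow> y \<notin> A"
    using assms(2) by (rule wfE_min') blast
  have "(x, y) \<in> r" if "y \<in> A - {x}" for y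
    using that x to[unfolded total_on_def, rule_format, of x y] by auto
  thus ?thesis using x(1) by auto
qed

lemma preferences_insert_top:
  assumes "x \<in> A" "r \<in> preferences (A - {x})"
  shows "r \<union> {x} \<times> (A - {x}) \<in> preferences A"
  unfolding preferences_iff
proof (intro conjI)
  have sub: "r \<subseteq> (A - {x}) \<times> (A - {x})" and ir: "\<forall>a. (a, a) \<notin> r"
    and tr: "\<forall>a b c. (a, b) \<in> r \<longrightarrow> (b, c) \<in> r \<longrightarrow> (a, c) \<in> r"
    and to: "\<forall>a\<in>A - {x}. \<forall>b\<in>A - {x}. a \<noteq> b \<longrightarrow> (a, b) \<in> r \<or> (b, a) \<in> r"
    using assms(2) unfolding preferences_iff by simp_all
  let ?s = "r \<union> {x} \<times> (A - {x})"
  show "?s \<subseteq> A \<times> A" using sub assms(1) by auto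
  show "\<forall>a b c. (a, b) \<in> ?s \<longrightarrow> (b, c) \<in> ?s \<longrightarrow> (a, c) \<in> ?s"
  proof (intro allI impI)
    fix a b c assume ab: "(a, b) \<in> ?s" and bc: "(b, c) \<in> ?s"
    have "b \<noteq> x" using ab sub by auto
    hence r: "(b, c) \<in> r" using bc by simp
    hence "c \<in> A - {x}" using sub by auto
    moreover have "(a, c) \<in> r" if "(a, b) \<in> r" using that r tr by metis
    ultimately show "(a, c) \<in> ?s" using ab by auto
  qed
  show "\<forall>a. (a, a) \<notin> ?s" using ir by auto
  show "\<forall>a\<in>A. \<forall>b\<in>A. a \<noteq> b \<longrightarrow> (a, b) \<in> ?s \<or> (b, a) \<in> ?s" using to by auto
qed

lemma preferences_remove_top:
  assumes "x \<in> A" "r \<in> preferences A" "\<forall>y\<in>A - {x}. (x, y) \<in> r"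
  shows "r \<inter> (A - {x}) \<times> (A - {x}) \<in> preferences (A - {x})"
    and "r = r \<inter> (A - {x}) \<times> (A - {x}) \<union> {x} \<times> (A - {x})"
proof -
  have tr: "\<forall>a b c. (a, b) \<in> r \<longrightarrow> (b, c) \<in> r \<longrightarrow> (a, c) \<in> r" and ir: "\<forall>a. (a, a) \<notin> r"
    and to: "\<forall>a\<in>A. \<forall>b\<in>A. a \<noteq> b \<longrightarrow> (a, b) \<in> r \<or> (b, a) \<in> r"
    and sub: "r \<subseteq> A \<times> A"
    using assms(2) unfolding preferences_iff by simp_all
  show "r \<inter> (A - {x}) \<times> (A - {x}) \<in> preferences (A - {x})"
    unfolding preferences_iff
  proof (intro conjI)
    show "\<forall>a b c. (a, b) \<in> r \<inter> (A - {x}) \<times> (A - {x}) \<longrightarrow>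
        (b, c) \<in> r \<inter> (A - {x}) \<times> (A - {x}) \<longrightarrow> (a, c) \<in> r \<inter> (A - {x}) \<times> (A - {x})"
    proof (intro allI impI)
      fix a b c assume *: "(a, b) \<in> r \<inter> (A - {x}) \<times> (A - {x})"
        "(b, c) \<in> r \<inter> (A - {x}) \<times> (A - {x})"
      hence "(a, c) \<in> r" using tr by (metis IntD1)
      thus "(a, c) \<in> r \<inter> (A - {x}) \<times> (A - {x})" using * by simp
    qed
  qed (use ir to in auto)
  have nx: "(y, x) \<notin> r" for y
  proof
    assume yx: "(y, x) \<in> r"
    hence "y \<in> A - {x}" using sub ir by auto
    hence "(x, y) \<in> r" using assms(3) by simp
    thus False using yx tr ir by metis
  qed
  show "r = r \<inter> (A - {x}) \<times> (A - {x}) \<union> {x} \<times> (A - {x})"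
  proof (intro equalityI subrelI)
    fix a b assume ab: "(a, b) \<in> r"
    hence "a \<in> A" "b \<in> A" "b \<noteq> x" using sub nx by auto
    thus "(a, b) \<in> r \<inter> (A - {x}) \<times> (A - {x}) \<union> {x} \<times> (A - {x})" using ab by simp
  next
    fix a b assume "(a, b) \<in> r \<inter> (A - {x}) \<times> (A - {x}) \<union> {x} \<times> (A - {x})"
    thus "(a, b) \<in> r" using assms(3) by auto
  qed
qed

lemma card_preferences:
  assumes "finite A"
  shows "card (preferences A) = fact (card A)"
  using assms
proof (induction "card A" arbitrary: A)
  case 0
  hence "preferences A = {{}}"
    by (auto simp: preferences_def strict_linear_order_on_def trans_def irrefl_def total_on_def)
  thus ?case using 0 by simp
next
  case (Suc n)
  let ?g = "\<lambda>x r. r \<union> {x} \<times> (A - {x})"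
  have A: "finite A" "A \<noteq> {}" using Suc by auto
  have eq: "preferences A = (\<Union>x\<in>A. ?g x ` preferences (A - {x}))"
  proof (intro equalityI subsetI)
    fix r assume r: "r \<in> preferences A"
    then obtain x where x: "x \<in> A" "\<forall>y\<in>A - {x}. (x, y) \<in> r"
      using preferences_max[OF A] by blast
    show "r \<in> (\<Union>x\<in>A. ?g x ` preferences (A - {x}))"
      using preferences_remove_top(1)[OF x(1) r x(2)] preferences_remove_top(2)[OF x(1) r x(2)]
      by (intro UN_I[OF x(1)] image_eqI) simp_all
  next
    fix r assume "r \<in> (\<Union>x\<in>A. ?g x ` preferences (A - {x}))"
    then obtain x s where "x \<in> A" "s \<in> preferences (A - {x})" "r = ?g x s" by auto
    thus "r \<in> preferences A" using preferences_insert_top by simp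
  qed
  have fin: "finite (preferences B)" if "finite B" for B :: "'a set"
    by (rule finite_subset[of _ "Pow (B \<times> B)"]) (use that in \<open>auto simp: preferences_def\<close>)
  have inj: "inj_on (?g x) (preferences (A - {x}))" for x
  proof (rule inj_onI)
    fix r s assume rs: "r \<in> preferences (A - {x})" "s \<in> preferences (A - {x})" "?g x r = ?g x s"
    hence "r \<subseteq> (A - {x}) \<times> (A - {x})" "s \<subseteq> (A - {x}) \<times> (A - {x})"
      by (auto simp: preferences_def)
    hence "r = ?g x r \<inter> (A - {x}) \<times> (A - {x})" "s = ?g x s \<inter> (A - {x}) \<times> (A - {x})"
      by auto
    thus "r = s" using rs(3) by simp
  qed
  have disj: "?g x ` preferences (A - {x}) \<inter> ?g y ` preferences (A - {y}) = {}"
    if "x \<in> A" "y \<in> A" "x \<noteq> y" for x y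
  proof -
    have False if "r \<in> preferences (A - {x})" "s \<in> preferences (A - {y})" "?g x r = ?g y s" for r s
    proof -
      have "(y, x) \<in> ?g x r" unfolding that(3) using \<open>x \<in> A\<close> \<open>x \<noteq> y\<close> by simp
      thus False using that(1) \<open>x \<noteq> y\<close> by (auto simp: preferences_def)
    qed
    thus ?thesis by blast
  qed
  have "card (preferences A) = (\<Sum>x\<in>A. card (?g x ` preferences (A - {x})))"
    unfolding eq using A fin disj by (intro card_UN_disjoint) auto
  also have "\<dots> = (\<Sum>x\<in>A. fact n)"
  proof (rule sum.cong)
    fix x assume "x \<in> A"
    hence c: "n = card (A - {x})" using Suc.hyps(2) A by simp
    show "card (?g x ` preferences (A - {x})) = fact n"
      using Suc.hyps(1)[OF c] A c by (simp add: card_image[OF inj])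
  qed simp
  also have "\<dots> = fact (Suc n)" using Suc.hyps(2)[symmetric] by simp
  finally show ?case using Suc.hyps(2) by metis
qed

lemma ex_enum_preferences:
  assumes "finite A" "card A = K"
  shows "\<exists>e :: nat \<Rightarrow> _. bij_betw e {1..fact K} (preferences A)"
proof -
  have "card (preferences A) = fact K" using card_preferences assms by auto
  moreover from this have "finite (preferences A)" by (metis card.infinite fact_nonzero)
  ultimately show ?thesis by (intro finite_same_card_bij) auto
qed

lemma count_profile_of_freqs:
  fixes e :: "nat \<Rightarrow> _"
  assumes "bij_betw e {1..fact K} (preferences A)" "i \<in> {1..fact K}"
  shows "count_list (profile_of_freqs K e B) (e i) = B i"
proof -
  have inj: "inj_on e {1..fact K}" using assms(1) by (rule bij_betw_imp_inj_on)
  have rep: "count_list (replicate n x) y = (if x = y then n else 0)" for n and x y :: "'a rel"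
    by (induction n) auto
  have cat: "count_list (concat xss) y = (\<Sum>xs\<leftarrow>xss. count_list xs y)" for xss and y :: "'a rel"
    by (induction xss) auto
  have "count_list (profile_of_freqs K e B) (e i) =
      (\<Sum>j\<leftarrow>[1..<Suc (fact K)]. if e j = e i then B j else 0)"
    by (simp add: profile_of_freqs_def cat rep comp_def del: upt_Suc)
  also have "\<dots> = (\<Sum>j\<in>{1..fact K}. if e j = e i then B j else 0)"
    by (subst sum_list_distinct_conv_sum_set) (simp_all del: upt_Suc add: atLeastLessThanSuc_atLeastAtMost)
  also have "\<dots> = (\<Sum>j\<in>{1..fact K}. if j = i then B j else 0)"
    using inj assms(2) by (intro sum.cong) (auto simp: inj_on_def)
  also have "\<dots> = B i" using assms(2) by (simp add: sum.delta)
  finally show ?thesis .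
qed

end

theory Submission
  imports Defs
begin

text \<open>Fix a consensus candidate \<open>r0\<close>. For every outcome of the \<open>K!\<close> frequencies, some permutation
  of them makes them decreasing along an enumeration of the preferences by increasing distance
  from \<open>r0\<close>. The frequencies are i.i.d., so permuting them does not change their joint law, and the
  union bound over the \<open>(K!)!\<close> permutations gives probability at least \<open>1 / (K!)!\<close>.\<close>

text \<open>Stable sorting by the key \<open>g\<close> settles ties. It is used twice below, to line
  up the order of \<open>g\<close> with that of \<open>X\<close>.\<close>

lemma ex_sorted_enumeration:
  fixes g :: "'i::linorder \<Rightarrow> 'b::linorder"
  assumes "finite I"
  obtains h where "bij_betw h {..<card I} I" "\<And>k l. k \<le> l \<Longrightarrow> l < card I \<Longrightarrow> g (h k) \<le> g (h l)"
proof -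
  define xs where "xs = sort_key g (sorted_list_of_set I)"
  have xs: "distinct xs" "set xs = I" "length xs = card I" "sorted (map g xs)"
    using assms by (simp_all add: xs_def)
  show thesis
  proof (rule that)
    show "bij_betw ((!) xs) {..<card I} I"
      using xs by (intro bij_betw_nth) auto
    show "g (xs ! k) \<le> g (xs ! l)" if "k \<le> l" "l < card I" for k l
      using sorted_nth_mono[OF xs(4), of k l] that xs(3) by simp
  qed
qed

text \<open>\<open>p\<close> sends the element in position k of the \<open>g\<close>-order to the
  one in position n - 1 - k of the \<open>X\<close>-order, so \<open>X \<circ> p\<close> decreases
  weakly along the \<open>g\<close>-order. Only strict inequalities of \<open>X\<close> are
  constrained, so ties may be broken arbitrarily.\<close>

lemma ex_permutation_antimonotone:
  fixes X :: "'i::linorder \<Rightarrow> 'b::linorder" and g :: "'i \<Rightarrow> 'c::linorder"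
  assumes "finite I"
  obtains p where "p permutes I" "\<And>i j. i \<in> I \<Longrightarrow> j \<in> I \<Longrightarrow> X (p i) > X (p j) \<Longrightarrow> g i \<le> g j"
proof -
  define n where "n = card I"
  obtain h where h: "bij_betw h {..<n} I" "\<And>k l. k \<le> l \<Longrightarrow> l < n \<Longrightarrow> g (h k) \<le> g (h l)"
    using ex_sorted_enumeration[OF assms] unfolding n_def by metis
  obtain h' where h': "bij_betw h' {..<n} I" "\<And>k l. k \<le> l \<Longrightarrow> l < n \<Longrightarrow> X (h' k) \<le> X (h' l)"
    using ex_sorted_enumeration[OF assms] unfolding n_def by metis
  \<comment> \<open>Order reversal of the positions 0, ..., n - 1; on them it is its own
    inverse.\<close>
  define \<rho> where "\<rho> k = n - 1 - k" for k
  have \<rho>: "bij_betw \<rho> {..<n} {..<n}"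
    by (rule bij_betw_byWitness[where f' = \<rho>]) (auto simp: \<rho>_def)
  define q where "q = inv_into {..<n} h"
  have q: "bij_betw q I {..<n}"
    unfolding q_def using h(1) by (rule bij_betw_inv_into)
  define p where "p i = (if i \<in> I then h' (\<rho> (q i)) else i)" for i
  have "bij_betw (h' \<circ> (\<rho> \<circ> q)) I I"
    using q \<rho> h'(1) by (intro bij_betw_trans)
  hence "bij_betw p I I"
    by (subst bij_betw_cong[where g = "h' \<circ> (\<rho> \<circ> q)"]) (auto simp: p_def)
  hence p: "p permutes I"
    by (rule bij_imp_permutes) (simp add: p_def)
  have "g i \<le> g j" if ij: "i \<in> I" "j \<in> I" "X (p i) > X (p j)" for i j
  proof -
    have qn: "q i < n" "q j < n"
      using bij_betw_apply[OF q] ij by auto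
    \<comment> \<open>If \<open>i\<close> came after \<open>j\<close> in the \<open>g\<close>-order,
      reversal would place \<open>p i\<close> no later than \<open>p j\<close> in the
      \<open>X\<close>-order, against X (p i) > X (p j).\<close>
    have "q i \<le> q j"
    proof (rule ccontr)
      assume "\<not> q i \<le> q j"
      hence "X (h' (\<rho> (q i))) \<le> X (h' (\<rho> (q j)))"
        using qn by (intro h'(2)) (auto simp: \<rho>_def)
      thus False using ij by (simp add: p_def)
    qed
    hence "g (h (q i)) \<le> g (h (q j))" using qn by (intro h(2))
    thus ?thesis
      using ij bij_betw_inv_into_right[OF h(1)] by (simp add: q_def)
  qed
  with p show thesis by (rule that)
qed

text \<open>The bound depends on \<open>P\<close> and \<open>g\<close> in no way, which makes the
  final constant uniform in the number of trials.\<close>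

lemma prob_iid_antimonotone_ge:
  fixes P :: "'b::linorder pmf" and g :: "'i::linorder \<Rightarrow> 'c::linorder"
  assumes I: "finite I"
  shows "measure_pmf.prob (Pi_pmf I dflt (\<lambda>_. P)) {X. \<forall>i\<in>I. \<forall>j\<in>I. X i > X j \<longrightarrow> g i \<le> g j}
           \<ge> 1 / fact (card I)"
proof -
  let ?M = "Pi_pmf I dflt (\<lambda>_. P)"
  define E where "E = {X :: 'i \<Rightarrow> 'b. \<forall>i\<in>I. \<forall>j\<in>I. X i > X j \<longrightarrow> g i \<le> g j}"
  define F where "F p = (\<lambda>X. X \<circ> p) -` E" for p :: "'i \<Rightarrow> 'i"
  have F: "measure_pmf.prob ?M (F p) = measure_pmf.prob ?M E" if "p permutes I" for p
  proof -
    \<comment> \<open>\<open>p\<close> maps the complement of \<open>I\<close> to itself, so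
      \<open>X \<circ> p\<close> still takes the value \<open>dflt\<close> there.\<close>
    have "map_pmf (\<lambda>X. X \<circ> p) ?M = ?M"
      using I that
      by (intro Pi_pmf_bij_betw[symmetric]) (simp_all add: permutes_imp_bij permutes_in_image)
    moreover have "measure_pmf.prob ?M (F p) = measure_pmf.prob (map_pmf (\<lambda>X. X \<circ> p) ?M) E"
      unfolding F_def by (rule measure_map_pmf[symmetric])
    ultimately show ?thesis by simp
  qed
  \<comment> \<open>Every outcome can be rearranged into \<open>E\<close>; the events may overlap
    because of ties, hence a union bound rather than a sum.\<close>
  have "(\<Union>p\<in>{p. p permutes I}. F p) = UNIV"
  proof (intro equalityI subsetI UNIV_I)
    fix X :: "'i \<Rightarrow> 'b"
    obtain p where "p permutes I" "\<And>i j. i \<in> I \<Longrightarrow> j \<in> I \<Longrightarrow> X (p i) > X (p j) \<Longrightarrow> g i \<le> g j"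
      using ex_permutation_antimonotone[OF I] by metis
    thus "X \<in> (\<Union>p\<in>{p. p permutes I}. F p)" by (auto simp: F_def E_def)
  qed
  hence "1 = measure_pmf.prob ?M (\<Union>p\<in>{p. p permutes I}. F p)"
    by simp
  also have "\<dots> \<le> (\<Sum>p\<in>{p. p permutes I}. measure_pmf.prob ?M (F p))"
    using I by (intro measure_subadditive_finite) (auto simp: finite_permutations)
  also have "\<dots> = fact (card I) * measure_pmf.prob ?M E"
    using I by (simp add: F card_permutations)
  finally show ?thesis
    unfolding E_def by (simp add: field_simps)
qed

theorem proposition2:
  fixes K :: nat
  assumes "K \<ge> 3"
  shows "\<exists>C > 0. \<forall>(A :: 'a set) (e :: nat \<Rightarrow> 'a rel) (m :: nat).
           finite A \<and> card A = K \<and> bij_betw e {1..fact K} (preferences A) \<and> m > 0 \<longrightarrow>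
           prob_flexible_consensus m K A e \<ge> C"
proof (intro exI[of _ "1 / fact (fact K) :: real"] conjI allI impI)
  fix A :: "'a set" and e :: "nat \<Rightarrow> 'a rel" and m :: nat
  assume "finite A \<and> card A = K \<and> bij_betw e {1..fact K} (preferences A) \<and> m > 0"
  hence e: "bij_betw e {1..fact K} (preferences A)" by simp
  let ?I = "{1..fact K :: nat}"
  \<comment> \<open>Any fixed preference would serve as centre; index 1 always lies in the
    range.\<close>
  define g where "g i = inversion_dist A (e i) (e 1)" for i
  have consensus: "flexible_consensus A (profile_of_freqs K e B) (e 1)"
    if B: "\<forall>i\<in>?I. \<forall>j\<in>?I. B i > B j \<longrightarrow> g i \<le> g j" for B
  proof -
    have "preferences A = e ` ?I" using e by (simp add: bij_betw_imp_surj_on)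
    moreover have "1 \<in> ?I" by simp
    ultimately show ?thesis
      using B by (auto simp: flexible_consensus_def count_profile_of_freqs[OF e] g_def)
  qed
  let ?M = "Pi_pmf ?I 0 (\<lambda>_. binomial_pmf m (1 / fact K))"
  \<comment> \<open>The outer factorial counts the permutations of the K! indices.\<close>
  have "1 / fact (fact K) \<le> measure_pmf.prob ?M {B. \<forall>i\<in>?I. \<forall>j\<in>?I. B i > B j \<longrightarrow> g i \<le> g j}"
    using prob_iid_antimonotone_ge[of ?I 0 "binomial_pmf m (1 / fact K)" g] by simp
  also have "\<dots> \<le> measure_pmf.prob ?M
      (profile_of_freqs K e -` {\<pi>. \<exists>r0. flexible_consensus A \<pi> r0})"
  proof (rule measure_pmf.finite_measure_mono)
    show "{B. \<forall>i\<in>?I. \<forall>j\<in>?I. B i > B j \<longrightarrow> g i \<le> g j}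
        \<subseteq> profile_of_freqs K e -` {\<pi>. \<exists>r0. flexible_consensus A \<pi> r0}"
      (is "?S \<subseteq> _")
    proof
      fix B assume "B \<in> ?S"
      hence "flexible_consensus A (profile_of_freqs K e B) (e 1)" by (intro consensus) (simp only: mem_Collect_eq)
      thus "B \<in> profile_of_freqs K e -` {\<pi>. \<exists>r0. flexible_consensus A \<pi> r0}" by auto
    qed
  qed simp
  also have "\<dots> = prob_flexible_consensus m K A e"
    by (simp add: prob_flexible_consensus_def random_profile_def)
  finally show "1 / fact (fact K) \<le> prob_flexible_consensus m K A e" .
qed simp

end
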